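(* Let $k$ be an odd positive integer. For every integer $n>0$, let $b=\lfloor \log_2 n\rfloor$ and $c=n+1-2^{b}$. Then $$a_k(n)=\frac{(2^b+c)^k+(2^b-c)^k}{2^{b+1}}.$$
   Context: A P-position of the game of Nim with $k$ piles is a $k$-tuple $(p_1,\dots,p_k)$ of non-negative integers whose nim-sum $p_1\oplus\cdots\oplus p_k$ is $0$, where $\oplus$ denotes bitwise XOR. $a_k(n)$ denotes the number of P-positions with $k$ piles such that every pile has at most $n$ counters. *)

theory Defs
  imports Complex_Main
begin

unbundle bit_operations_syntax

definition nim_sum :: "nat list \<Rightarrow> nat" where
  "nim_sum ps = foldr (XOR) ps 0"

definition nim_P_position :: "nat \<Rightarrow> nat list \<Rightarrow> bool" where
  "nim_P_position k ps \<longleftrightarrow> length ps = k \<and> nim_sum ps = 0"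

definition num_P_positions :: "nat \<Rightarrow> nat \<Rightarrow> nat" where
  "num_P_positions k n = card {ps. nim_P_position k ps \<and> (\<forall>p\<in>set ps. p \<le> n)}"

end

theory Submission imports Defs begin

text \<open>
  Let \<open>N = 2 ^ b\<close>, so that the piles lie in \<open>{..n} \<subseteq> {..<2 * N}\<close> and exactly \<open>c\<close> of the
  admissible values are \<open>\<ge> N\<close>. Splitting on the first pile gives a linear recurrence for the
  numbers of lists with nim-sum \<open>< N\<close> and \<open>\<ge> N\<close>, whose solution is
  \<open>((N + c) ^ k \<plusminus> (N - c) ^ k) / 2\<close>. For odd \<open>k\<close> a list with nim-sum \<open>< N\<close> has a pile \<open>< N\<close>;
  replacing the first such pile \<open>p\<close> by \<open>p XOR t\<close> shows that each of the \<open>N\<close> nim-sums \<open>t < N\<close>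
  occurs equally often, so the nim-sum \<open>0\<close> accounts for a fraction \<open>1 / N\<close> of these lists.
\<close>

definition pile_lists :: "nat \<Rightarrow> nat \<Rightarrow> nat list set" where
  "pile_lists k n = {ps. length ps = k \<and> (\<forall>p\<in>set ps. p \<le> n)}"

lemma pile_lists_0: "pile_lists 0 n = {[]}"
  by (auto simp: pile_lists_def)

lemma pile_lists_alt: "pile_lists k n = {ps. set ps \<subseteq> {..n} \<and> length ps = k}"
  by (auto simp: pile_lists_def)

lemma finite_pile_lists: "finite (pile_lists k n)"
  unfolding pile_lists_alt by (simp add: finite_lists_length_eq)

lemma card_pile_lists: "card (pile_lists k n) = (n + 1) ^ k"
  unfolding pile_lists_alt by (simp add: card_lists_length_eq)

lemma nim_sum_Nil [simp]: "nim_sum [] = 0"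
  and nim_sum_Cons [simp]: "nim_sum (p # ps) = p XOR nim_sum ps"
  by (simp_all add: nim_sum_def)

lemma xor_less_power2: "(p XOR q :: nat) < 2 ^ m" if "p < 2 ^ m" "q < 2 ^ m"
proof -
  have "take_bit m (p XOR q) = p XOR q"
    using that by (simp add: take_bit_nat_eq_self)
  then show ?thesis
    by (simp only: take_bit_nat_eq_self_iff)
qed

lemma less_power2_iff_not_bit: "p < 2 ^ m \<longleftrightarrow> \<not> bit p m" if "p < 2 ^ Suc m" for p :: nat
proof -
  have "p div 2 ^ m < 2"
    using that by (simp add: less_mult_imp_div_less)
  then have "p div 2 ^ m = 0 \<or> p div 2 ^ m = 1" by linarith
  then show ?thesis
    by (auto simp: bit_iff_odd div_eq_0_iff)
qed

text \<open>For numbers below \<open>2 ^ Suc m\<close>, lying below \<open>2 ^ m\<close> means that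
  bit \<open>m\<close> is clear, and XOR adds these bits modulo 2.\<close>

lemma xor_less_power2_iff:
  fixes p q :: nat
  assumes "p < 2 ^ Suc m" "q < 2 ^ Suc m"
  shows "p XOR q < 2 ^ m \<longleftrightarrow> (p < 2 ^ m \<longleftrightarrow> q < 2 ^ m)"
  using less_power2_iff_not_bit[OF assms(1)] less_power2_iff_not_bit[OF assms(2)]
    less_power2_iff_not_bit[OF xor_less_power2[OF assms]]
  by (auto simp: bit_xor_iff)

lemma nim_sum_less_power2: "(\<forall>p\<in>set ps. p < 2 ^ m) \<Longrightarrow> nim_sum ps < 2 ^ m"
  by (induction ps) (auto intro: xor_less_power2)

text \<open>Every pile has bit \<open>m\<close> set, so bit \<open>m\<close> of the nim-sum is the
  parity of the number of piles.\<close>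

lemma nim_sum_less_iff_even:
  assumes "\<forall>p\<in>set ps. 2 ^ m \<le> p \<and> p < 2 ^ Suc m"
  shows "nim_sum ps < 2 ^ m \<longleftrightarrow> even (length ps)"
  using assms
proof (induction ps)
  case (Cons p ps)
  have "p < 2 ^ Suc m" "nim_sum ps < 2 ^ Suc m"
    using Cons.prems nim_sum_less_power2[of ps "Suc m"] by auto
  from xor_less_power2_iff[OF this] show ?case
    using Cons by simp
qed simp

text \<open>For \<open>t < 2 ^ m\<close> the altered pile stays below \<open>2 ^ m\<close>, so a
  second application finds the same pile and undoes the change. A list without small piles is left
  alone.\<close>

fun shift_pile :: "nat \<Rightarrow> nat \<Rightarrow> nat list \<Rightarrow> nat list" where
  "shift_pile m t [] = []"
| "shift_pile m t (p # ps) =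
    (if p < 2 ^ m then (p XOR t) # ps else p # shift_pile m t ps)"

lemma shift_pile_involutive: "t < 2 ^ m \<Longrightarrow> shift_pile m t (shift_pile m t ps) = ps"
  by (induction ps) (auto simp: xor_less_power2 xor.assoc)

lemma shift_pile_mem:
  assumes "t < 2 ^ m" "2 ^ m \<le> n" "ps \<in> pile_lists k n"
  shows "shift_pile m t ps \<in> pile_lists k n"
  using assms(3)
proof (induction ps arbitrary: k)
  case (Cons p ps)
  have "p XOR t \<le> n" if "p < 2 ^ m"
    using xor_less_power2[OF that assms(1)] assms(2) by simp
  with Cons.prems Cons.IH[of "length ps"] show ?case
    by (auto simp: pile_lists_def)
qed (simp add: pile_lists_def)

lemma nim_sum_shift_pile:
  "\<exists>p\<in>set ps. p < 2 ^ m \<Longrightarrow> nim_sum (shift_pile m t ps) = nim_sum ps XOR t"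
proof (induction ps)
  case (Cons p ps)
  show ?case
  proof (cases "p < 2 ^ m")
    case False
    then have "nim_sum (shift_pile m t ps) = nim_sum ps XOR t"
      using Cons by auto
    with False show ?thesis by (simp add: xor.assoc)
  qed (simp add: ac_simps)
qed simp

text \<open>This is where the parity of \<open>k\<close> enters: an odd number of piles, all with
  bit \<open>m\<close> set, would give a nim-sum with bit \<open>m\<close> set.\<close>

lemma ex_small_pile:
  assumes "odd k" "n < 2 ^ Suc m" "ps \<in> pile_lists k n" "nim_sum ps < 2 ^ m"
  shows "\<exists>p\<in>set ps. p < 2 ^ m"
proof (rule ccontr)
  assume "\<not> ?thesis"
  then have "\<forall>p\<in>set ps. 2 ^ m \<le> p \<and> p < 2 ^ Suc m"
    using assms(2,3) by (force simp: pile_lists_def)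
  from nim_sum_less_iff_even[OF this] show False
    using assms by (simp add: pile_lists_def)
qed

lemma card_nim_sum_eq:
  assumes "odd k" "2 ^ m \<le> n" "n < 2 ^ Suc m" "t < 2 ^ m"
  shows "card {ps \<in> pile_lists k n. nim_sum ps = t} = card {ps \<in> pile_lists k n. nim_sum ps = 0}"
proof -
  \<comment> \<open>The map is its own inverse and exchanges the two nim-sums, as
    \<open>t XOR t = 0\<close> and \<open>0 XOR t = t\<close>; both are below \<open>2 ^ m\<close>,
    so a small pile exists on either side.\<close>
  have "bij_betw (shift_pile m t) {ps \<in> pile_lists k n. nim_sum ps = t}
          {ps \<in> pile_lists k n. nim_sum ps = 0}"
    using assms ex_small_pile[OF assms(1,3)]
    by (intro bij_betw_byWitness[where f' = "shift_pile m t"])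
      (auto simp: shift_pile_mem shift_pile_involutive nim_sum_shift_pile)
  then show ?thesis
    by (rule bij_betw_same_card)
qed

lemma card_nim_sum_less:
  assumes "odd k" "2 ^ m \<le> n" "n < 2 ^ Suc m"
  shows "card {ps \<in> pile_lists k n. nim_sum ps < 2 ^ m} =
    2 ^ m * card {ps \<in> pile_lists k n. nim_sum ps = 0}"
proof -
  have "{ps \<in> pile_lists k n. nim_sum ps < 2 ^ m} =
      (\<Union>t\<in>{..<2 ^ m}. {ps \<in> pile_lists k n. nim_sum ps = t})"
    by auto
  also have "card \<dots> = (\<Sum>t\<in>{..<2 ^ m}. card {ps \<in> pile_lists k n. nim_sum ps = t})"
    by (rule card_UN_disjoint) (auto simp: finite_pile_lists)
  also have "\<dots> = (\<Sum>t\<in>{..<2 ^ m :: nat}. card {ps \<in> pile_lists k n. nim_sum ps = 0})"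
    by (intro sum.cong refl card_nim_sum_eq[OF assms]) simp
  finally show ?thesis by simp
qed

text \<open>The first pile and the nim-sum of the rest must lie on the same side of
  \<open>2 ^ m\<close>; there are \<open>2 ^ m\<close> small and \<open>n + 1 - 2 ^ m\<close> large
  choices for that pile.\<close>

lemma card_nim_sum_less_Suc:
  assumes "2 ^ m \<le> n" "n < 2 ^ Suc m"
  shows "card {ps \<in> pile_lists (Suc k) n. nim_sum ps < 2 ^ m} =
    2 ^ m * card {ps \<in> pile_lists k n. nim_sum ps < 2 ^ m} +
    (n + 1 - 2 ^ m) * card {ps \<in> pile_lists k n. \<not> nim_sum ps < 2 ^ m}"
    (is "card ?L = 2 ^ m * card ?S + _ * card ?B")
proof -
  have less: "nim_sum (p # ps) < 2 ^ m \<longleftrightarrow> (p < 2 ^ m \<longleftrightarrow> nim_sum ps < 2 ^ m)"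
    if "p \<le> n" "ps \<in> pile_lists k n" for p ps
    using that assms(2) nim_sum_less_power2[of ps "Suc m"]
    unfolding nim_sum_Cons by (intro xor_less_power2_iff) (force simp: pile_lists_def)+
  have L: "?L = (\<lambda>(p, ps). p # ps) ` ({..<2 ^ m} \<times> ?S \<union> {2 ^ m..n} \<times> ?B)" (is "_ = ?f ` ?R")
  proof (intro equalityI subsetI)
    fix qs assume qs: "qs \<in> ?L"
    then obtain p ps where "qs = p # ps" "p \<le> n" "ps \<in> pile_lists k n"
      by (cases qs) (auto simp: pile_lists_def)
    with qs less show "qs \<in> ?f ` ?R"
      by (auto simp del: nim_sum_Cons)
  next
    fix qs assume "qs \<in> ?f ` ?R"
    then obtain p ps where ps: "qs = p # ps" "p \<le> n" "ps \<in> pile_lists k n"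
        "p < 2 ^ m \<longleftrightarrow> nim_sum ps < 2 ^ m"
      using assms(1) by auto
    then show "qs \<in> ?L"
      using less[of p ps] by (auto simp: pile_lists_def simp del: nim_sum_Cons)
  qed
  have "card ?L = card ?R"
    unfolding L by (rule card_image) (auto simp: inj_on_def)
  moreover have "card ?R = card ({..<2 ^ m :: nat} \<times> ?S) + card ({2 ^ m..n} \<times> ?B)"
    by (rule card_Un_disjoint) (auto simp: finite_pile_lists)
  ultimately show ?thesis
    by (simp add: card_cartesian_product)
qed

text \<open>With S and B counting the lists of small and large nim-sum, each new pile multiplies S +
  B by \<open>2 ^ m + c\<close> and S - B by \<open>2 ^ m - c\<close>. All \<open>k\<close> are
  covered because the induction passes through even lengths.\<close>

lemma card_nim_sum_less_closed_form:
  assumes "2 ^ m \<le> n" "n < 2 ^ Suc m"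
  defines "c \<equiv> real n + 1 - 2 ^ m"
  shows "real (card {ps \<in> pile_lists k n. nim_sum ps < 2 ^ m}) =
    ((2 ^ m + c) ^ k + (2 ^ m - c) ^ k) / 2"
proof (induction k)
  case 0
  have "{ps \<in> pile_lists 0 n. nim_sum ps < 2 ^ m} = {[]}"
    by (auto simp: pile_lists_0)
  then show ?case by simp
next
  case (Suc k)
  let ?S = "{ps \<in> pile_lists k n. nim_sum ps < 2 ^ m}"
  let ?B = "{ps \<in> pile_lists k n. \<not> nim_sum ps < 2 ^ m}"
  have "card (pile_lists k n) = card ?S + card ?B"
    by (subst card_Un_disjoint[symmetric])
      (auto simp: finite_pile_lists intro!: arg_cong[where f = card])
  then have "real (card ?S) + real (card ?B) = real ((n + 1) ^ k)"
    unfolding card_pile_lists by linarith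
  \<comment> \<open>Here \<open>n + 1\<close> is rewritten as \<open>2 ^ m + c\<close>.\<close>
  then have B: "real (card ?B) = (2 ^ m + c) ^ k - real (card ?S)"
    by (simp add: c_def algebra_simps)
  have "real (n + 1 - 2 ^ m) = c"
    using assms(1) by (simp add: c_def of_nat_diff)
  then have "real (card {ps \<in> pile_lists (Suc k) n. nim_sum ps < 2 ^ m}) =
      2 ^ m * real (card ?S) + c * real (card ?B)"
    by (simp add: card_nim_sum_less_Suc[OF assms(1,2)])
  then show ?case
    by (simp add: B Suc.IH field_simps)
qed

theorem theorem15:
  fixes k n b :: nat and c :: real
  assumes "odd k" and "n > 0"
    and "b = nat \<lfloor>log 2 (real n)\<rfloor>"
    and "c = real n + 1 - 2 ^ b"
  shows "real (num_P_positions k n) = ((2 ^ b + c) ^ k + (2 ^ b - c) ^ k) / 2 ^ (b + 1)"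
proof -
  \<comment> \<open>Since \<open>n\<close> is at least 1, the logarithm is nonnegative and
    \<open>nat\<close> truncates nothing.\<close>
  have "\<lfloor>log 2 (real n)\<rfloor> = int b"
    using assms(2,3) by simp
  then have n: "2 ^ b \<le> n" "n < 2 ^ Suc b"
    using floor_log_nat_eq_powr_iff[of 2 n b] assms(2) by simp_all
  have "num_P_positions k n = card {ps \<in> pile_lists k n. nim_sum ps = 0}"
    unfolding num_P_positions_def nim_P_position_def pile_lists_def
    by (rule arg_cong[where f = card]) auto
  then have "2 ^ b * real (num_P_positions k n) = ((2 ^ b + c) ^ k + (2 ^ b - c) ^ k) / 2"
    using card_nim_sum_less[OF assms(1) n] card_nim_sum_less_closed_form[OF n, of k]
    by (simp add: assms(4))
  then show ?thesis
    by (simp add: field_simps)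
qed

end
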